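(* Let $q\in\mathbb{C}$ with $0<|q|<1$ and let $w\in\mathbb{C}\setminus\{0\}$ with $w\neq q^{\ell}$ for all $\ell\in\mathbb{Z}$. Then $$g_{3,1}(w;q)=g_{3,2}(w;q),$$ and if in addition $|w|>|q|$, then $$g_{3,1}(w;q)=g_{3,2}(w;q)=g_{3,3}(w;q).$$
   Context: Notation: $(a)_n=(a;q)_n:=\prod_{j=0}^{n-1}(1-aq^j)$ for $n\in\mathbb{N}_0$, and $(a_1,\dots,a_r)_n=(a_1,\dots,a_r;q)_n:=(a_1;q)_n\cdots(a_r;q)_n$. Definitions: $$g_{3,1}(w;q):=g_3(w;q):=\sum_{n\ge 0}\frac{q^{n(n+1)}}{(w,w^{-1}q)_{n+1}},$$ $$R(w;q):=1+\sum_{n\ge1}\frac{q^{n^2}}{(wq)_n(w^{-1}q)_n},\qquad g_{3,2}(w;q):=-\frac1w+\frac{1}{w(1-w)}R(w;q),$$ and, for $|w|>|q|$ and $w$ such that no denominator vanishes, $$g_{3,3}(w;q):=\sum_{n\ge0}\frac{w^{-n}q^n}{(w)_{n+1}}.$$ *)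

theory Defs
  imports Complex_Main
begin

text \<open>The finite q-Pochhammer symbol \<open>(a; q)\<^sub>n\<close>; a multi-parameter symbol \<open>(a, b; q)\<^sub>n\<close> is written
  out below as the product \<open>(a; q)\<^sub>n (b; q)\<^sub>n\<close>.\<close>

definition qpoch :: "complex \<Rightarrow> complex \<Rightarrow> nat \<Rightarrow> complex" where
  "qpoch a q n = (\<Prod>j<n. 1 - a * q ^ j)"

definition g31 :: "complex \<Rightarrow> complex \<Rightarrow> complex" where
  "g31 w q = (\<Sum>n. q ^ (n * (n + 1)) / (qpoch w q (n + 1) * qpoch (inverse w * q) q (n + 1)))"

text \<open>In \<open>R(w; q)\<close> the summation over \<open>n \<ge> 1\<close> is shifted to start at \<open>0\<close>.\<close>

definition rank_R :: "complex \<Rightarrow> complex \<Rightarrow> complex" where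
  "rank_R w q =
    1 + (\<Sum>n. q ^ ((Suc n)\<^sup>2) / (qpoch (w * q) q (Suc n) * qpoch (inverse w * q) q (Suc n)))"

definition g32 :: "complex \<Rightarrow> complex \<Rightarrow> complex" where
  "g32 w q = - (1 / w) + 1 / (w * (1 - w)) * rank_R w q"

text \<open>The series is only meaningful for \<open>\<bar>w\<bar> > \<bar>q\<bar>\<close> and nonvanishing denominators.\<close>

definition g33 :: "complex \<Rightarrow> complex \<Rightarrow> complex" where
  "g33 w q = (\<Sum>n. w powi (- int n) * q ^ n / qpoch w q (n + 1))"

end

theory Submission
  imports Defs "HOL-Analysis.Infinite_Products"
begin

text \<open>With \<open>A\<^sub>n = q\<^bsup>n\<^sup>2\<^esup> / ((w)\<^sub>n (q/w)\<^sub>n)\<close>, the \<open>n\<close>-th term of \<open>R(w; q) / (1 - w)\<close> minus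
  \<open>w\<close> times the \<open>n\<close>-th term of \<open>g\<^sub>3\<^sub>,\<^sub>1\<close> is \<open>A\<^sub>n - A\<^sub>n\<^sub>+\<^sub>1\<close>, so the difference of the two series
  telescopes to \<open>A\<^sub>0 = 1\<close>; this is \<open>g\<^sub>3\<^sub>,\<^sub>1 = g\<^sub>3\<^sub>,\<^sub>2\<close>.
  The equality with \<open>g\<^sub>3\<^sub>,\<^sub>3\<close> is the case \<open>a = 0\<close>, \<open>t = q/w\<close> of the Rogers--Fine identity. It is
  obtained by iterating the functional equation
  \<open>(1 - t) H(w, t) = (1 + w t q H(w q, t q)) / (1 - w)\<close> of \<open>H(w, t) = \<Sum>n. t\<^sup>n / (w)\<^sub>n\<^sub>+\<^sub>1\<close>.\<close>

lemma qpoch_0 [simp]: "qpoch a q 0 = 1"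
  by (simp add: qpoch_def)

lemma qpoch_Suc: "qpoch a q (Suc n) = qpoch a q n * (1 - a * q ^ n)"
  by (simp add: qpoch_def)

lemma qpoch_Suc_shift: "qpoch a q (Suc n) = (1 - a) * qpoch (a * q) q n"
  by (simp add: qpoch_def prod.lessThan_Suc_shift mult_ac del: prod.lessThan_Suc)

lemma qpoch_nonzero:
  assumes "\<And>j. a * q ^ j \<noteq> 1"
  shows "qpoch a q n \<noteq> 0"
  using assms by (fastforce simp: qpoch_def)

text \<open>Since \<open>a * q ^ j\<close> is absolutely summable and no factor vanishes, the finite
  symbols tend to a nonzero infinite product. Their inverses therefore converge and are
  bounded.\<close>

lemma inverse_qpoch_bounded:
  assumes q: "norm q < 1" and nz: "\<And>j. a * q ^ j \<noteq> 1"
  obtains C where "C > 0" "\<And>n. norm (inverse (qpoch a q n)) \<le> C"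
proof -
  have "summable (\<lambda>j. norm (- a * q ^ j))"
    using q by (simp add: norm_mult norm_power summable_mult summable_geometric)
  then have "convergent_prod (\<lambda>j. 1 + (- a * q ^ j))"
    by (intro abs_convergent_prod_imp_convergent_prod summable_imp_abs_convergent_prod) simp
  then have conv: "convergent_prod (\<lambda>j. 1 - a * q ^ j)"
    by simp
  have "\<And>j. 1 - a * q ^ j \<noteq> 0"
    using nz by (metis eq_iff_diff_eq_0)
  with conv obtain L where L: "(\<lambda>n. \<Prod>j\<le>n. 1 - a * q ^ j) \<longlonglongrightarrow> L" "L \<noteq> 0"
    using convergent_prod_iff_nz_lim[of "\<lambda>j. 1 - a * q ^ j"] by auto
  then have "(\<lambda>n. qpoch a q (Suc n)) \<longlonglongrightarrow> L"
    by (simp add: qpoch_def lessThan_Suc_atMost del: prod.lessThan_Suc)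
  then have "(\<lambda>n. qpoch a q n) \<longlonglongrightarrow> L"
    by (rule LIMSEQ_imp_Suc)
  then have "Bseq (\<lambda>n. inverse (qpoch a q n))"
    using L(2) by (intro convergent_imp_Bseq convergentI[OF tendsto_inverse])
  then show thesis
    using that by (auto simp: Bseq_def)
qed

text \<open>The term is the n-th power of \<open>c * q ^ n\<close>, which tends to 0, so a geometric
  series of ratio 1/2 eventually dominates.\<close>

lemma summable_power_times_power_square:
  fixes c q :: complex
  assumes "norm q < 1"
  shows "summable (\<lambda>n. norm (c ^ n * q ^ n\<^sup>2))"
proof -
  have "(\<lambda>n. norm (c * q ^ n)) \<longlonglongrightarrow> norm (c * 0)"
    using assms by (intro tendsto_intros LIMSEQ_power_zero)
  then have "\<forall>\<^sub>F n in sequentially. norm (c * q ^ n) < 1 / 2"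
    by (rule order_tendstoD) simp
  then have "\<forall>\<^sub>F n in sequentially. norm (norm (c ^ n * q ^ n\<^sup>2)) \<le> (1 / 2) ^ n"
  proof eventually_elim
    case (elim n)
    have "c ^ n * q ^ n\<^sup>2 = (c * q ^ n) ^ n"
      by (simp add: power_mult_distrib power_mult power2_eq_square)
    then have "norm (c ^ n * q ^ n\<^sup>2) = norm (c * q ^ n) ^ n"
      by (simp only: norm_power)
    with elim show ?case
      by (simp add: power_mono)
  qed
  then show ?thesis
    by (rule summable_comparison_test_ev) (simp add: summable_geometric)
qed

text \<open>The free base \<open>c\<close> and the offsets \<open>k\<close>, \<open>l\<close> let
  one statement cover both the terms of \<open>g31\<close> and the telescoping sequence
  \<open>A\<close>.\<close>

lemma summable_qpoch_square_series:
  fixes c q a b :: complex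
  assumes q: "norm q < 1"
    and a: "\<And>j. a * q ^ j \<noteq> 1" and b: "\<And>j. b * q ^ j \<noteq> 1"
  shows "summable (\<lambda>n. c ^ n * q ^ n\<^sup>2 / (qpoch a q (k + n) * qpoch b q (l + n)))"
proof -
  obtain A where A: "A > 0" "\<And>n. norm (inverse (qpoch a q n)) \<le> A"
    using inverse_qpoch_bounded[OF q a] by blast
  obtain B where B: "B > 0" "\<And>n. norm (inverse (qpoch b q n)) \<le> B"
    using inverse_qpoch_bounded[OF q b] by blast
  show ?thesis
  proof (rule summable_comparison_test')
    show "summable (\<lambda>n. norm (c ^ n * q ^ n\<^sup>2) * (A * B))"
      by (intro summable_mult2 summable_power_times_power_square q)
    fix n
    have "norm (inverse (qpoch a q (k + n))) * norm (inverse (qpoch b q (l + n))) \<le> A * B"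
      using A B by (intro mult_mono) auto
    then have "norm (c ^ n * q ^ n\<^sup>2) *
        (norm (inverse (qpoch a q (k + n))) * norm (inverse (qpoch b q (l + n))))
        \<le> norm (c ^ n * q ^ n\<^sup>2) * (A * B)"
      by (rule mult_left_mono) simp
    then show "norm (c ^ n * q ^ n\<^sup>2 / (qpoch a q (k + n) * qpoch b q (l + n)))
        \<le> norm (c ^ n * q ^ n\<^sup>2) * (A * B)"
      by (simp add: norm_mult norm_divide norm_inverse divide_inverse)
  qed
qed

lemma g31_eq_g32:
  fixes q w :: complex
  assumes q: "norm q < 1" and w: "w \<noteq> 0"
    and a: "\<And>j. w * q ^ j \<noteq> 1" and b: "\<And>j. inverse w * q * q ^ j \<noteq> 1"
  shows "g31 w q = g32 w q"
proof -
  define P where "P = qpoch w q"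
  define Q where "Q = qpoch (inverse w * q) q"
  define A where "A n = q ^ n\<^sup>2 / (P n * Q n)" for n
  define G where "G n = q ^ (n * (n + 1)) / (P (n + 1) * Q (n + 1))" for n
  define r where "r n = q ^ n\<^sup>2 / (qpoch (w * q) q n * Q n)" for n
  have P0: "P n \<noteq> 0" and Q0: "Q n \<noteq> 0" for n
    unfolding P_def Q_def by (rule qpoch_nonzero, rule a, rule qpoch_nonzero, rule b)
  have w1: "1 - w \<noteq> 0"
    using a[of 0] by simp
  have step: "r n / (1 - w) - w * G n = A n - A (Suc n)" for n
  proof -
    have r: "r n / (1 - w) = q ^ n\<^sup>2 / (P (Suc n) * Q n)"
      by (simp add: r_def P_def qpoch_Suc_shift)
    have fP: "P (Suc n) = P n * (1 - w * q ^ n)"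
      by (simp add: P_def qpoch_Suc)
    have fQ: "Q (Suc n) = Q n * (1 - inverse w * q * q ^ n)"
      by (simp add: Q_def qpoch_Suc)
    have e1: "q ^ (n * (n + 1)) = q ^ n\<^sup>2 * q ^ n"
      by (simp add: power2_eq_square power_add)
    have e2: "q ^ (Suc n)\<^sup>2 = q ^ n\<^sup>2 * (q ^ n * q ^ n * q)"
      by (simp add: power2_eq_square power_add)
    have x: "1 - w * q ^ n \<noteq> 0" "1 - inverse w * q * q ^ n \<noteq> 0"
      using P0[of "Suc n"] Q0[of "Suc n"] fP fQ by auto
    define X Y where "X = 1 - w * q ^ n" and "Y = 1 - inverse w * q * q ^ n"
    \<comment> \<open>Over the common denominator \<open>P (Suc n) * Q (Suc n)\<close>, the two
      sides of \<open>step\<close> have these numerators, up to the factor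
      \<open>q ^ n\<^sup>2\<close>.\<close>
    have key: "Y - w * q ^ n = X * Y - q ^ n * q ^ n * q"
      using w by (simp add: X_def Y_def field_simps)
    have "r n / (1 - w) - w * G n = q ^ n\<^sup>2 * (Y - w * q ^ n) / (P n * X * (Q n * Y))"
      unfolding r G_def Suc_eq_plus1[symmetric] fP fQ
      unfolding Suc_eq_plus1 e1 X_def[symmetric] Y_def[symmetric]
      using P0[of n] Q0[of n] x[folded X_def Y_def] by (simp add: field_simps)
    also have "\<dots> = A n - A (Suc n)"
      unfolding key A_def e2 fP fQ X_def[symmetric] Y_def[symmetric]
      using P0[of n] Q0[of n] x[folded X_def Y_def] by (simp add: field_simps)
    finally show ?thesis .
  qed
  have sG: "summable G"
    using summable_qpoch_square_series[OF q a b, where c = q and k = 1 and l = 1]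
    by (simp add: G_def[abs_def] P_def Q_def power_add power2_eq_square mult_ac)
  have "summable A"
    using summable_qpoch_square_series[OF q a b, where c = 1 and k = 0 and l = 0]
    by (simp add: A_def[abs_def] P_def Q_def)
  then have "(\<lambda>n. A n - A (Suc n)) sums (A 0 - 0)"
    by (intro telescope_sums' summable_LIMSEQ_zero)
  then have "(\<lambda>n. r n / (1 - w) - w * G n) sums 1"
    by (simp add: step A_def P_def Q_def)
  \<comment> \<open>Adding the summable series back yields the convergence of \<open>r\<close>
    together with its value.\<close>
  then have "(\<lambda>n. (r n / (1 - w) - w * G n) + w * G n) sums (1 + w * suminf G)"
    by (intro sums_add sums_mult summable_sums sG)
  then have "(\<lambda>n. (1 - w) * (r n / (1 - w))) sums ((1 - w) * (1 + w * suminf G))"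
    by (intro sums_mult) simp
  then have r_sums: "r sums ((1 - w) * (1 + w * suminf G))"
    using w1 by simp
  have "rank_R w q = r 0 + (\<Sum>n. r (Suc n))"
    by (simp add: rank_R_def r_def Q_def)
  also have "\<dots> = suminf r"
    using suminf_split_head[OF sums_summable[OF r_sums]] by simp
  also have "\<dots> = (1 - w) * (1 + w * suminf G)"
    using r_sums by (rule sums_unique[symmetric])
  finally have "g32 w q = - (1 / w) + (1 + w * suminf G) / w"
    using w1 by (simp add: g32_def)
  then have "g32 w q = suminf G"
    using w by (simp add: add_divide_distrib)
  then show ?thesis
    by (simp add: g31_def G_def[abs_def] P_def Q_def)
qed

lemma rogers_fine_0:
  fixes q w t :: complex
  assumes q: "norm q < 1" and t1: "norm t < 1"
    and a: "\<And>j. w * q ^ j \<noteq> 1" and b: "\<And>j. t * q ^ j \<noteq> 1"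
  shows "(\<lambda>n. (w * t) ^ n * q ^ n\<^sup>2 / (qpoch w q (n + 1) * qpoch t q (n + 1)))
    sums (\<Sum>n. t ^ n / qpoch w q (n + 1))"
proof -
  define P where "P = qpoch w q"
  define T where "T = qpoch t q"
  \<comment> \<open>As \<open>P (N + m + 1)\<close> is \<open>P N\<close> times the symbol of
    \<open>w * q ^ N\<close> of length m + 1, \<open>S N\<close> is H(w q^N, t q^N) divided by
    \<open>P N\<close>. With this normalisation a single bound on the inverses of \<open>P\<close>
    serves all \<open>N\<close>.\<close>
  define h where "h N m = (t * q ^ N) ^ m / P (N + m + 1)" for N m
  define S where "S N = (\<Sum>m. h N m)" for N
  define c where "c n = (w * t) ^ n * q ^ n\<^sup>2" for n
  have P0: "P n \<noteq> 0" and T0: "T n \<noteq> 0" for n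
    unfolding P_def T_def by (rule qpoch_nonzero, rule a, rule qpoch_nonzero, rule b)
  obtain C where C: "C > 0" "\<And>n. norm (inverse (P n)) \<le> C"
    unfolding P_def using inverse_qpoch_bounded[OF q a] by blast
  obtain B where B: "B > 0" "\<And>n. norm (inverse (T n)) \<le> B"
    unfolding T_def using inverse_qpoch_bounded[OF q b] by blast
  have h_bound: "norm (h N m) \<le> norm t ^ m * C" for N m
  proof -
    have "norm (t * q ^ N) \<le> norm t * 1"
      unfolding norm_mult norm_power using q by (intro mult_left_mono power_le_one) auto
    then have "norm (t * q ^ N) ^ m * norm (inverse (P (N + m + 1))) \<le> norm t ^ m * C"
      using C by (intro mult_mono power_mono) auto
    then show ?thesis
      by (simp add: h_def divide_inverse norm_mult norm_power)
  qed
  have geo: "summable (\<lambda>m. norm t ^ m * C)"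
    using t1 by (intro summable_mult2 summable_geometric) simp
  have sh: "summable (h N)" for N
    using geo h_bound by (rule summable_comparison_test')
  have S_bound: "norm (S N) \<le> (\<Sum>m. norm t ^ m * C)" for N
    unfolding S_def using h_bound geo by (rule norm_suminf_le)
  \<comment> \<open>The functional equation of H at (w q^N, t q^N), divided by
    \<open>P N\<close>.\<close>
  have S_rec: "(1 - t * q ^ N) * S N = 1 / P (N + 1) + w * t * q ^ (2 * N + 1) * S (Suc N)" for N
  proof -
    \<comment> \<open>Subtracting the inverses of consecutive values of \<open>P\<close> leaves a
      factor \<open>w * q ^ (N + m + 1)\<close>, whose part \<open>q ^ m\<close> turns powers of
      \<open>t * q ^ N\<close> into powers of \<open>t * q ^ Suc N\<close>.\<close>
    have h_rec: "h N (Suc m) - t * q ^ N * h N m = w * t * q ^ (2 * N + 1) * h (Suc N) m" for m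
    proof -
      have "P (N + Suc m + 1) = P (N + m + 1) * (1 - w * q ^ (N + m + 1))"
        by (simp add: P_def qpoch_Suc)
      moreover have "1 - w * q ^ (N + m + 1) \<noteq> 0"
        using a[of "N + m + 1"] by simp
      ultimately have "h N (Suc m) - t * q ^ N * h N m
          = (t * q ^ N) ^ Suc m * (w * q ^ (N + m + 1)) / P (N + Suc m + 1)"
        using P0[of "N + m + 1"] by (simp add: h_def divide_simps) (simp add: algebra_simps)
      also have "\<dots> = w * t * q ^ (2 * N + 1) * h (Suc N) m"
        by (simp add: h_def power_mult_distrib power_add power_mult power2_eq_square mult_ac)
      finally show ?thesis .
    qed
    have "S N = h N 0 + (\<Sum>m. h N (Suc m))"
      unfolding S_def using suminf_split_head[OF sh] by simp
    moreover have "(\<Sum>m. h N (Suc m)) - t * q ^ N * S N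
        = (\<Sum>m. h N (Suc m) - t * q ^ N * h N m)"
      using suminf_diff[OF summable_Suc_iff[THEN iffD2, OF sh] summable_mult[OF sh],
        of N "t * q ^ N" N]
      unfolding S_def suminf_mult[OF sh] .
    moreover have "(\<Sum>m. h N (Suc m) - t * q ^ N * h N m) = w * t * q ^ (2 * N + 1) * S (Suc N)"
      unfolding S_def h_rec by (rule suminf_mult[OF sh])
    ultimately show ?thesis
      by (simp add: h_def algebra_simps)
  qed
  \<comment> \<open>The recurrence unrolled \<open>N\<close> times: the odd exponents 2j + 1 for j <
    N add up to the square in \<open>c N\<close>.\<close>
  have partial: "S 0 = (\<Sum>n<N. c n / (P (n + 1) * T (n + 1))) + c N / T N * S N" for N
  proof (induction N)
    case 0
    then show ?case by (simp add: c_def T_def)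
  next
    case (Suc N)
    have x: "1 - t * q ^ N \<noteq> 0"
      using b[of N] by simp
    have T: "T (Suc N) = T N * (1 - t * q ^ N)"
      by (simp add: T_def qpoch_Suc)
    have c: "c (Suc N) = c N * (w * t * q ^ (2 * N + 1))"
      by (simp add: c_def power2_eq_square power_add power_mult mult_ac)
    have "c N / T N * S N = c N / T (Suc N) * ((1 - t * q ^ N) * S N)"
      using x T0[of N] by (simp add: T)
    also have "\<dots> = c N / (P (N + 1) * T (N + 1)) + c (Suc N) / T (Suc N) * S (Suc N)"
      unfolding S_rec c by (simp add: algebra_simps)
    finally show ?case
      using Suc.IH by simp
  qed
  \<comment> \<open>The remainder vanishes because \<open>S N\<close> and the inverse of
    \<open>T N\<close> are bounded uniformly in \<open>N\<close> while \<open>c N\<close> tends to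
    0.\<close>
  have "(\<lambda>N. norm (c N) * (B * (\<Sum>m. norm t ^ m * C))) \<longlonglongrightarrow> 0"
    unfolding c_def
    by (intro tendsto_mult_left_zero summable_LIMSEQ_zero summable_power_times_power_square q)
  then have "(\<lambda>N. c N / T N * S N) \<longlonglongrightarrow> 0"
  proof (rule Lim_null_comparison[rotated], intro always_eventually allI)
    fix N
    have "norm (inverse (T N)) * norm (S N) \<le> B * (\<Sum>m. norm t ^ m * C)"
      using B S_bound by (intro mult_mono) auto
    then have "norm (c N) * (norm (inverse (T N)) * norm (S N))
        \<le> norm (c N) * (B * (\<Sum>m. norm t ^ m * C))"
      by (rule mult_left_mono) simp
    then show "norm (c N / T N * S N) \<le> norm (c N) * (B * (\<Sum>m. norm t ^ m * C))"
      by (simp add: norm_mult divide_inverse mult_ac)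
  qed
  then have "(\<lambda>N. S 0 - c N / T N * S N) \<longlonglongrightarrow> S 0 - 0"
    by (intro tendsto_intros)
  moreover have "S 0 - c N / T N * S N = (\<Sum>n<N. c n / (P (n + 1) * T (n + 1)))" for N
    using partial[of N] by simp
  ultimately have "(\<lambda>n. c n / (P (n + 1) * T (n + 1))) sums S 0"
    by (simp add: sums_def)
  then show ?thesis
    by (simp add: c_def S_def h_def P_def T_def)
qed

theorem theorem3p1:
  fixes q w :: complex
  assumes "0 < norm q" and "norm q < 1"
    and "w \<noteq> 0"
    and "\<forall>l::int. w \<noteq> q powi l"
  shows "g31 w q = g32 w q \<and>
    (norm w > norm q \<longrightarrow> g31 w q = g32 w q \<and> g32 w q = g33 w q)"
proof -
  have q0: "q \<noteq> 0"
    using assms(1) by auto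
  \<comment> \<open>Exponents l \<le> 0 are excluded to keep the symbols of \<open>w\<close>
    nonzero, exponents l > 0 to keep those of q/w nonzero.\<close>
  have a: "w * q ^ j \<noteq> 1" for j
  proof
    assume "w * q ^ j = 1"
    then have "w = q powi (- int j)"
      using q0 by (simp add: power_int_minus field_simps)
    with assms(4) show False by blast
  qed
  have b: "inverse w * q * q ^ j \<noteq> 1" for j
  proof
    assume "inverse w * q * q ^ j = 1"
    then have "w = q powi (int (Suc j))"
      using assms(3) by (simp only: power_int_of_nat) (simp add: field_simps)
    with assms(4) show False by blast
  qed
  have eq: "g31 w q = g32 w q"
    using assms(2,3) a b by (rule g31_eq_g32)
  moreover have "g31 w q = g33 w q" if "norm w > norm q"
  proof -
    \<comment> \<open>For t = q/w the product \<open>w * t\<close> is \<open>q\<close>, so the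
      numerators \<open>(w * t) ^ n * q ^ n\<^sup>2\<close> become those of
      \<open>g31\<close>.\<close>
    have "norm (inverse w * q) < 1"
      using that assms(3) by (simp add: norm_divide field_simps)
    from sums_unique[OF rogers_fine_0[OF assms(2) this a b]] assms(3) show ?thesis
      by (simp add: g31_def g33_def power_int_minus power_mult_distrib power_inverse
          power_add power2_eq_square mult_ac)
  qed
  ultimately show ?thesis by simp
qed

end
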